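(* Let $U,V$ be theories in the same signature and $\phi$ a sentence of that signature such that $U\cup V\cup\{\phi\}$ is consistent. If $(U+\phi,V+\phi)$ is computably inseparable, then $(U+\phi,V)$ is computably inseparable.
   Context: $T+\phi$ denotes $T\cup\{\phi\}$; $T_{\mathfrak p}$ is the set of theorems of $T$ and $T_{\mathfrak r}=\{\psi\mid T\vdash\neg\psi\}$. For theories $S,T$ in the same signature that are jointly consistent, the pair $(S,T)$ is computably inseparable iff there is no computable set $\mathcal Z$ with $S_{\mathfrak p}\subseteq\mathcal Z$ and $T_{\mathfrak r}\cap\mathcal Z=\emptyset$. *)

theory Defs
  imports Main "HOL-Library.Nat_Bijection"
begin

section \<open>First-order logic with equality\<close>

text \<open>Symbols are named by natural numbers. A signature assigns an arity to exactly those
  function and relation symbols that belong to it; constants are function symbols of arity 0.\<close>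

record signature =
  fun_arity :: "nat \<rightharpoonup> nat"
  rel_arity :: "nat \<rightharpoonup> nat"

text \<open>Variables are de Bruijn indices.\<close>

datatype tm = Var nat | Fun nat "tm list"

datatype fm =
    Eq tm tm
  | Rel nat "tm list"
  | Bot
  | Imp fm fm
  | All fm

abbreviation Neg :: "fm \<Rightarrow> fm" where
  "Neg \<phi> \<equiv> Imp \<phi> Bot"

fun wf_tm :: "signature \<Rightarrow> tm \<Rightarrow> bool" where
  "wf_tm L (Var n) \<longleftrightarrow> True"
| "wf_tm L (Fun f ts) \<longleftrightarrow> fun_arity L f = Some (length ts) \<and> (\<forall>t\<in>set ts. wf_tm L t)"

fun wf_fm :: "signature \<Rightarrow> fm \<Rightarrow> bool" where
  "wf_fm L (Eq s t) \<longleftrightarrow> wf_tm L s \<and> wf_tm L t"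
| "wf_fm L (Rel r ts) \<longleftrightarrow> rel_arity L r = Some (length ts) \<and> (\<forall>t\<in>set ts. wf_tm L t)"
| "wf_fm L Bot \<longleftrightarrow> True"
| "wf_fm L (Imp \<phi> \<psi>) \<longleftrightarrow> wf_fm L \<phi> \<and> wf_fm L \<psi>"
| "wf_fm L (All \<phi>) \<longleftrightarrow> wf_fm L \<phi>"

fun fv_tm :: "tm \<Rightarrow> nat set" where
  "fv_tm (Var n) = {n}"
| "fv_tm (Fun f ts) = (\<Union>t\<in>set ts. fv_tm t)"

fun fv_fm :: "fm \<Rightarrow> nat set" where
  "fv_fm (Eq s t) = fv_tm s \<union> fv_tm t"
| "fv_fm (Rel r ts) = (\<Union>t\<in>set ts. fv_tm t)"
| "fv_fm Bot = {}"
| "fv_fm (Imp \<phi> \<psi>) = fv_fm \<phi> \<union> fv_fm \<psi>"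
| "fv_fm (All \<phi>) = {n. Suc n \<in> fv_fm \<phi>}"

definition sentence :: "signature \<Rightarrow> fm \<Rightarrow> bool" where
  "sentence L \<phi> \<longleftrightarrow> wf_fm L \<phi> \<and> fv_fm \<phi> = {}"

text \<open>Simultaneous substitution; \<open>lift_subst\<close> adapts a substitution to the scope of a quantifier.\<close>

fun subst_tm :: "(nat \<Rightarrow> tm) \<Rightarrow> tm \<Rightarrow> tm" where
  "subst_tm \<sigma> (Var n) = \<sigma> n"
| "subst_tm \<sigma> (Fun f ts) = Fun f (map (subst_tm \<sigma>) ts)"

definition lift_subst :: "(nat \<Rightarrow> tm) \<Rightarrow> nat \<Rightarrow> tm" where
  "lift_subst \<sigma> = case_nat (Var 0) (\<lambda>n. subst_tm (\<lambda>k. Var (Suc k)) (\<sigma> n))"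

fun subst_fm :: "(nat \<Rightarrow> tm) \<Rightarrow> fm \<Rightarrow> fm" where
  "subst_fm \<sigma> (Eq s t) = Eq (subst_tm \<sigma> s) (subst_tm \<sigma> t)"
| "subst_fm \<sigma> (Rel r ts) = Rel r (map (subst_tm \<sigma>) ts)"
| "subst_fm \<sigma> Bot = Bot"
| "subst_fm \<sigma> (Imp \<phi> \<psi>) = Imp (subst_fm \<sigma> \<phi>) (subst_fm \<sigma> \<psi>)"
| "subst_fm \<sigma> (All \<phi>) = All (subst_fm (lift_subst \<sigma>) \<phi>)"

definition shift :: "fm \<Rightarrow> fm" where
  "shift = subst_fm (\<lambda>n. Var (Suc n))"

definition inst :: "tm \<Rightarrow> fm \<Rightarrow> fm" where
  "inst t = subst_fm (case_nat t Var)"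

text \<open>Classical natural deduction in the language of \<open>L\<close>. In \<open>AllI\<close>, shifting the
  assumptions makes variable 0 fresh, which is the eigenvariable condition.\<close>

inductive proves :: "signature \<Rightarrow> fm set \<Rightarrow> fm \<Rightarrow> bool" for L where
  Ax: "\<phi> \<in> \<Gamma> \<Longrightarrow> wf_fm L \<phi> \<Longrightarrow> proves L \<Gamma> \<phi>"
| ImpI: "wf_fm L \<phi> \<Longrightarrow> proves L (insert \<phi> \<Gamma>) \<psi> \<Longrightarrow> proves L \<Gamma> (Imp \<phi> \<psi>)"
| ImpE: "proves L \<Gamma> (Imp \<phi> \<psi>) \<Longrightarrow> proves L \<Gamma> \<phi> \<Longrightarrow> proves L \<Gamma> \<psi>"
| Classical: "wf_fm L \<phi> \<Longrightarrow> proves L (insert (Neg \<phi>) \<Gamma>) Bot \<Longrightarrow> proves L \<Gamma> \<phi>"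
| AllI: "proves L (shift ` \<Gamma>) \<phi> \<Longrightarrow> proves L \<Gamma> (All \<phi>)"
| AllE: "proves L \<Gamma> (All \<phi>) \<Longrightarrow> wf_tm L t \<Longrightarrow> proves L \<Gamma> (inst t \<phi>)"
| EqI: "wf_tm L t \<Longrightarrow> proves L \<Gamma> (Eq t t)"
| EqE: "proves L \<Gamma> (Eq s t) \<Longrightarrow> wf_fm L \<phi> \<Longrightarrow> proves L \<Gamma> (inst s \<phi>) \<Longrightarrow> proves L \<Gamma> (inst t \<phi>)"

text \<open>A theory is given by its set of axioms, with no effectivity requirement.\<close>

definition is_theory :: "signature \<Rightarrow> fm set \<Rightarrow> bool" where
  "is_theory L T \<longleftrightarrow> (\<forall>\<phi>\<in>T. sentence L \<phi>)"

definition consistent :: "signature \<Rightarrow> fm set \<Rightarrow> bool" where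
  "consistent L T \<longleftrightarrow> \<not> proves L T Bot"

definition provables :: "signature \<Rightarrow> fm set \<Rightarrow> fm set" where
  "provables L T = {\<psi>. sentence L \<psi> \<and> proves L T \<psi>}"

definition refutables :: "signature \<Rightarrow> fm set \<Rightarrow> fm set" where
  "refutables L T = {\<psi>. sentence L \<psi> \<and> proves L T (Neg \<psi>)}"


section \<open>Computability\<close>

text \<open>\<open>recursive n f\<close>: on argument lists of length \<open>n\<close>, \<open>f\<close> is a total general recursive
  function. Only the values on lists of length \<open>n\<close> are meaningful. Minimization is
  restricted to regular functions, so that only total functions are generated.\<close>

inductive recursive :: "nat \<Rightarrow> (nat list \<Rightarrow> nat) \<Rightarrow> bool" where
  zero: "recursive n (\<lambda>xs. 0)"
| succ: "recursive 1 (\<lambda>xs. Suc (xs ! 0))"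
| proj: "i < n \<Longrightarrow> recursive n (\<lambda>xs. xs ! i)"
| comp: "recursive (length gs) f \<Longrightarrow> \<forall>g\<in>set gs. recursive n g
    \<Longrightarrow> recursive n (\<lambda>xs. f (map (\<lambda>g. g xs) gs))"
| prim_rec: "recursive n f \<Longrightarrow> recursive (Suc (Suc n)) g
    \<Longrightarrow> recursive (Suc n) (\<lambda>xs. rec_nat (f (tl xs)) (\<lambda>k r. g (k # r # tl xs)) (hd xs))"
| minimize: "recursive (Suc n) f \<Longrightarrow> \<forall>xs. length xs = n \<longrightarrow> (\<exists>k. f (k # xs) = 0)
    \<Longrightarrow> recursive n (\<lambda>xs. LEAST k. f (k # xs) = 0)"

definition computable :: "nat set \<Rightarrow> bool" where
  "computable A \<longleftrightarrow> (\<exists>f. recursive 1 f \<and> (\<forall>x. f [x] = (if x \<in> A then 1 else 0)))"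

fun code_tm :: "tm \<Rightarrow> nat" where
  "code_tm (Var n) = prod_encode (0, n)"
| "code_tm (Fun f ts) = prod_encode (Suc f, list_encode (map code_tm ts))"

fun code_fm :: "fm \<Rightarrow> nat" where
  "code_fm (Eq s t) = prod_encode (0, prod_encode (code_tm s, code_tm t))"
| "code_fm (Rel r ts) = prod_encode (1, prod_encode (r, list_encode (map code_tm ts)))"
| "code_fm Bot = prod_encode (2, 0)"
| "code_fm (Imp \<phi> \<psi>) = prod_encode (3, prod_encode (code_fm \<phi>, code_fm \<psi>))"
| "code_fm (All \<phi>) = prod_encode (4, code_fm \<phi>)"

lemma code_tm_inject: "code_tm s = code_tm t \<longleftrightarrow> s = t"
proof
  show "code_tm s = code_tm t \<Longrightarrow> s = t"
  proof (induction s arbitrary: t)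
    case (Var n)
    then show ?case by (cases t) (simp_all add: prod_encode_eq)
  next
    case (Fun f ts)
    then obtain us where t: "t = Fun f us" and m: "map code_tm ts = map code_tm us"
      by (cases t) (simp_all add: prod_encode_eq list_encode_eq)
    have "ts = us"
      using m Fun.IH by (auto simp: list_eq_iff_nth_eq dest: map_eq_imp_length_eq)
    with t show ?case by simp
  qed
qed simp

lemma code_fm_inject: "code_fm \<phi> = code_fm \<psi> \<longleftrightarrow> \<phi> = \<psi>"
proof
  have inj: "inj code_tm" by (simp add: inj_def code_tm_inject)
  show "code_fm \<phi> = code_fm \<psi> \<Longrightarrow> \<phi> = \<psi>"
    by (induction \<phi> arbitrary: \<psi>; case_tac \<psi>)
      (simp_all add: prod_encode_eq list_encode_eq code_tm_inject inj_map_eq_map[OF inj])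
qed simp

definition computable_fms :: "fm set \<Rightarrow> bool" where
  "computable_fms Z \<longleftrightarrow> computable (code_fm ` Z)"

text \<open>Intended for theories \<open>S\<close>, \<open>T\<close> in the signature \<open>L\<close> with \<open>S \<union> T\<close> consistent.\<close>

definition computably_inseparable :: "signature \<Rightarrow> fm set \<Rightarrow> fm set \<Rightarrow> bool" where
  "computably_inseparable L S T \<longleftrightarrow>
    \<not> (\<exists>Z. computable_fms Z \<and> provables L S \<subseteq> Z \<and> refutables L T \<inter> Z = {})"

end

theory Submission
  imports Defs
begin

text \<open>If \<open>Z\<close> separates the theorems of \<open>U + \<phi>\<close> from the sentences refuted by \<open>V\<close>, then
  \<open>{\<psi>. \<phi> \<and> \<psi> \<in> Z}\<close> separates the theorems of \<open>U + \<phi>\<close> from the sentences refuted by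
  \<open>V + \<phi>\<close>: \<open>U + \<phi>\<close> proves \<open>\<phi> \<and> \<psi>\<close> whenever it proves \<open>\<psi>\<close>, and \<open>V\<close> refutes \<open>\<phi> \<and> \<psi>\<close>
  whenever \<open>V + \<phi>\<close> refutes \<open>\<psi>\<close>. The new set is computable because the code of \<open>\<phi> \<and> \<psi>\<close> is a
  recursive function of the code of \<open>\<psi>\<close>.\<close>

text \<open>\<open>Imp\<close> and \<open>Bot\<close> are the only propositional primitives, so
  conjunction takes its classical form; its code is then three nested implication codes.\<close>

abbreviation Conj :: "fm \<Rightarrow> fm \<Rightarrow> fm" where
  "Conj \<phi> \<psi> \<equiv> Neg (Imp \<phi> (Neg \<psi>))"

lemma proves_mono: "proves L \<Gamma> \<phi> \<Longrightarrow> \<Gamma> \<subseteq> \<Delta> \<Longrightarrow> proves L \<Delta> \<phi>"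
proof (induction arbitrary: \<Delta> rule: proves.induct)
  case (Ax \<phi> \<Gamma>)
  then show ?case by (auto intro: proves.Ax)
next
  case (ImpI \<phi> \<Gamma> \<psi>)
  then show ?case by (meson insert_mono proves.ImpI)
next
  case (ImpE \<Gamma> \<phi> \<psi>)
  then show ?case by (meson proves.ImpE)
next
  case (Classical \<phi> \<Gamma>)
  then show ?case by (meson insert_mono proves.Classical)
next
  case (AllI \<Gamma> \<phi>)
  then show ?case by (meson image_mono proves.AllI)
next
  case (AllE \<Gamma> \<phi> t)
  then show ?case by (meson proves.AllE)
next
  case (EqI t \<Gamma>)
  then show ?case by (meson proves.EqI)
next
  case (EqE \<Gamma> s t \<phi>)
  then show ?case by (meson proves.EqE)
qed

lemma proves_ConjI:
  assumes "proves L \<Gamma> \<phi>" "proves L \<Gamma> \<psi>" "wf_fm L \<phi>" "wf_fm L \<psi>"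
  shows "proves L \<Gamma> (Conj \<phi> \<psi>)"
proof (rule proves.ImpI)
  let ?\<theta> = "Imp \<phi> (Neg \<psi>)"
  show wf: "wf_fm L ?\<theta>"
    using assms by simp
  have "proves L (insert ?\<theta> \<Gamma>) ?\<theta>"
    using wf by (intro proves.Ax) auto
  then show "proves L (insert ?\<theta> \<Gamma>) Bot"
    using assms proves_mono[OF _ subset_insertI] by (meson proves.ImpE)
qed

text \<open>Discharging \<open>\<phi>\<close> by \<open>ImpI\<close> leaves
  \<open>Imp \<phi> (Neg \<psi>)\<close> provable from \<open>\<Gamma>\<close> alone, and this is
  exactly what the conjunction denies. This moves \<open>\<phi>\<close> from the axioms into the
  refuted sentence.\<close>

lemma proves_Neg_Conj:
  assumes "proves L (insert \<phi> \<Gamma>) (Neg \<psi>)" "wf_fm L \<phi>" "wf_fm L \<psi>"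
  shows "proves L \<Gamma> (Neg (Conj \<phi> \<psi>))"
proof (rule proves.ImpI)
  show wf: "wf_fm L (Conj \<phi> \<psi>)"
    using assms by simp
  have "proves L (insert (Conj \<phi> \<psi>) \<Gamma>) (Conj \<phi> \<psi>)"
    using wf by (intro proves.Ax) auto
  moreover have "proves L (insert (Conj \<phi> \<psi>) \<Gamma>) (Imp \<phi> (Neg \<psi>))"
    using assms by (blast intro: proves_mono proves.ImpI)
  ultimately show "proves L (insert (Conj \<phi> \<psi>) \<Gamma>) Bot"
    by (rule proves.ImpE)
qed

lemma recursive_comp1:
  assumes "recursive 1 f" "recursive n g"
  shows "recursive n (\<lambda>xs. f [g xs])"
  using recursive.comp[of "[g]" f n] assms by simp

lemma recursive_comp2:
  assumes "recursive 2 f" "recursive n g" "recursive n h"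
  shows "recursive n (\<lambda>xs. f [g xs, h xs])"
  using recursive.comp[of "[g, h]" f n] assms by (simp add: numeral_2_eq_2)

lemma recursive_Suc: "recursive n g \<Longrightarrow> recursive n (\<lambda>xs. Suc (g xs))"
  using recursive_comp1[OF recursive.succ] by simp

lemma recursive_const: "recursive n (\<lambda>xs. k)"
  by (induction k) (auto intro: recursive.zero recursive_Suc)

lemma recursive_add:
  assumes "recursive n g" "recursive n h"
  shows "recursive n (\<lambda>xs. g xs + h xs)"
proof -
  \<comment> \<open>The list access stays unreduced to match the shape
    \<open>g (k # r # tl xs)\<close> in \<open>prim_rec\<close>: index 0 is the counter, index 1 the
    value so far.\<close>
  define add where "add = (\<lambda>xs. rec_nat (tl xs ! 0) (\<lambda>k r. Suc ((k # r # tl xs) ! 1)) (hd xs))"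
  have "recursive (Suc 1) add"
    unfolding add_def
    by (intro recursive.prim_rec recursive_Suc recursive.proj) simp_all
  then have "recursive 2 add"
    by (simp add: numeral_2_eq_2)
  moreover have "add [x, y] = x + y" for x y
    unfolding add_def by (induction x) auto
  ultimately show ?thesis
    using recursive_comp2[of add n g h] assms by simp
qed

lemma recursive_triangle:
  assumes "recursive n g"
  shows "recursive n (\<lambda>xs. triangle (g xs))"
proof -
  \<comment> \<open>The recursion is \<open>triangle (Suc k) = triangle k + Suc k\<close>, with no
    parameters besides the recursion argument.\<close>
  define tri where "tri = (\<lambda>xs::nat list. rec_nat 0
    (\<lambda>k r. (k # r # tl xs) ! 1 + Suc ((k # r # tl xs) ! 0)) (hd xs))"
  have "recursive (Suc 0) tri"
    unfolding tri_def
    by (rule recursive.prim_rec[OF recursive.zero, of 0 "\<lambda>xs. xs ! 1 + Suc (xs ! 0)"])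
      (intro recursive_add recursive_Suc recursive.proj; simp)
  moreover have "tri [x] = triangle x" for x
    unfolding tri_def by (induction x) auto
  ultimately show ?thesis
    using recursive_comp1[of tri n g] assms by simp
qed

text \<open>Cantor pairing sends \<open>(m, n)\<close> to \<open>triangle (m + n) + m\<close>, so
  sums and triangular numbers suffice.\<close>

lemma recursive_prod_encode:
  assumes "recursive n g" "recursive n h"
  shows "recursive n (\<lambda>xs. prod_encode (g xs, h xs))"
  unfolding prod_encode_def prod.case
  using assms by (intro recursive_add recursive_triangle)

text \<open>The map \<open>c\<close> is a many-one reduction: composing it with the characteristic
  function of \<open>A\<close> decides the preimage.\<close>

lemma computable_vimage:
  assumes "computable A" "recursive 1 (\<lambda>xs. c (xs ! 0))"
  shows "computable (c -` A)"
proof -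
  obtain f where f: "recursive 1 f" "\<And>x. f [x] = (if x \<in> A then 1 else 0)"
    using assms(1) unfolding computable_def by blast
  have "recursive 1 (\<lambda>xs. f [c (xs ! 0)])"
    using recursive_comp1[OF f(1) assms(2)] .
  then show ?thesis
    unfolding computable_def using f(2) by (intro exI[of _ "\<lambda>xs. f [c (xs ! 0)]"]) simp
qed

text \<open>Only implications carry the tag 3, so a formula code of this shape can be decoded one
  level.\<close>

lemma code_fm_eq_Imp:
  "code_fm \<theta> = prod_encode (3, prod_encode (a, b)) \<longleftrightarrow>
    (\<exists>\<phi> \<psi>. \<theta> = Imp \<phi> \<psi> \<and> code_fm \<phi> = a \<and> code_fm \<psi> = b)"
  by (cases \<theta>) (auto simp: prod_encode_eq)

lemma computable_fms_Conj:
  assumes "computable_fms Z"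
  shows "computable_fms {\<psi>. Conj \<phi> \<psi> \<in> Z}"
proof -
  define imp where "imp a b = prod_encode (3, prod_encode (a, b))" for a b
  \<comment> \<open>On the code of \<open>\<psi>\<close>, this gives the code of
    \<open>Conj \<phi> \<psi>\<close>; it is defined on all numbers, codes or not.\<close>
  define c where "c x = imp (imp (code_fm \<phi>) (imp x (code_fm Bot))) (code_fm Bot)" for x
  have "c x \<in> code_fm ` Z \<longleftrightarrow> x \<in> code_fm ` {\<psi>. Conj \<phi> \<psi> \<in> Z}" for x
  proof
    \<comment> \<open>Here \<open>x\<close> is not known to be a code. Decoding the three nested
      implications shows that it is one, and injectivity of \<open>code_fm\<close> identifies the
      fixed parts \<open>\<phi>\<close> and \<open>Bot\<close>.\<close>
    assume "c x \<in> code_fm ` Z"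
    then obtain \<theta> where "\<theta> \<in> Z" "code_fm \<theta> = c x"
      by (metis imageE)
    moreover from this obtain \<psi> where "\<theta> = Conj \<phi> \<psi>" "code_fm \<psi> = x"
      unfolding c_def imp_def code_fm_eq_Imp code_fm_inject by blast
    ultimately show "x \<in> code_fm ` {\<psi>. Conj \<phi> \<psi> \<in> Z}"
      by blast
  next
    assume "x \<in> code_fm ` {\<psi>. Conj \<phi> \<psi> \<in> Z}"
    then obtain \<psi> where "Conj \<phi> \<psi> \<in> Z" "x = code_fm \<psi>"
      by blast
    moreover from this have "c x = code_fm (Conj \<phi> \<psi>)"
      by (simp add: c_def imp_def)
    ultimately show "c x \<in> code_fm ` Z"
      by blast
  qed
  then have "code_fm ` {\<psi>. Conj \<phi> \<psi> \<in> Z} = c -` (code_fm ` Z)"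
    by auto
  moreover have "recursive 1 (\<lambda>xs. c (xs ! 0))"
    unfolding c_def imp_def
    by (intro recursive_prod_encode recursive_const recursive.proj) simp
  ultimately show ?thesis
    using assms computable_vimage unfolding computable_fms_def by simp
qed

theorem theorem2p4:
  fixes L :: signature and U V :: "fm set" and \<phi> :: fm
  assumes "is_theory L U" and "is_theory L V" and "sentence L \<phi>"
    and "consistent L (U \<union> V \<union> {\<phi>})"
    and "computably_inseparable L (U \<union> {\<phi>}) (V \<union> {\<phi>})"
  shows "computably_inseparable L (U \<union> {\<phi>}) V"
  unfolding computably_inseparable_def
proof
  assume "\<exists>Z. computable_fms Z \<and> provables L (U \<union> {\<phi>}) \<subseteq> Z \<and> refutables L V \<inter> Z = {}"
  then obtain Z where Z: "computable_fms Z" "provables L (U \<union> {\<phi>}) \<subseteq> Z"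
    "refutables L V \<inter> Z = {}"
    by blast
  let ?Z = "{\<psi>. Conj \<phi> \<psi> \<in> Z}"
  have wf: "wf_fm L \<phi>"
    using assms(3) by (simp add: sentence_def)
  \<comment> \<open>\<open>provables\<close> and \<open>refutables\<close> contain sentences only,
    so the conjunction must be one as well.\<close>
  have sentence_Conj: "sentence L (Conj \<phi> \<psi>)" if "sentence L \<psi>" for \<psi>
    using that assms(3) by (simp add: sentence_def)
  have "provables L (U \<union> {\<phi>}) \<subseteq> ?Z"
  proof
    fix \<psi> assume "\<psi> \<in> provables L (U \<union> {\<phi>})"
    then have \<psi>: "sentence L \<psi>" "proves L (U \<union> {\<phi>}) \<psi>"
      by (auto simp: provables_def)
    have "proves L (U \<union> {\<phi>}) \<phi>"
      using wf by (intro proves.Ax) auto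
    then have "proves L (U \<union> {\<phi>}) (Conj \<phi> \<psi>)"
      using \<psi> wf by (intro proves_ConjI) (auto simp: sentence_def)
    then show "\<psi> \<in> ?Z"
      using Z(2) sentence_Conj[OF \<psi>(1)] by (auto simp: provables_def)
  qed
  moreover have "refutables L (V \<union> {\<phi>}) \<inter> ?Z = {}"
  proof -
    have "Conj \<phi> \<psi> \<in> refutables L V" if "\<psi> \<in> refutables L (V \<union> {\<phi>})" for \<psi>
      using that wf sentence_Conj[of \<psi>] proves_Neg_Conj[of L \<phi> V \<psi>]
      by (auto simp: refutables_def sentence_def)
    then show ?thesis
      using Z(3) by blast
  qed
  ultimately show False
    using assms(5) computable_fms_Conj[OF Z(1)] unfolding computably_inseparable_def by blast
qed

end
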